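(* Let $n>5$ and let $S\in\mathcal D_n^s$ be such that both of its directed cycles have even length. Then: (i) if $n\equiv 0\pmod 4$, the maximal energy among such $S$ is attained by $S\cong D_n^s[2,n-2]$; (ii) if $n\equiv 2\pmod 4$, it is attained by $S\cong D_n^s[2,\boldsymbol{n-2}]$; (iii) if $n\equiv 1\pmod 4$, it is attained by $S\cong D_n^s[2,n-3]$; (iv) if $n\equiv 3\pmod 4$, it is attained by $S\cong D_n^s[2,\boldsymbol{n-3}]$; (v) the minimal energy among such $S$ is attained by $S\cong D_n^s[\boldsymbol 2,\boldsymbol 2]$ (whose energy is $0$).
   Context: A signed digraph (sidigraph) is a digraph in which every arc carries a sign $+1$ or $-1$; its adjacency matrix $A(S)=[a_{ij}]$ has $a_{ij}$ equal to the sign of the arc $w_iw_j$ if it exists and $0$ otherwise. If $\rho_1,\dots,\rho_n$ are the eigenvalues of $A(S)$, the energy of $S$ is $E(S)=\sum_{k=1}^n|\mathrm{Re}(\rho_k)|$. The sign of a directed cycle is the product of the signs of its arcs. For $k\ge 2$, $C_k$ denotes a directed cycle of length $k$ with sign $+1$ and $\boldsymbol{C}_k$ a directed cycle of length $k$ with sign $-1$. It is known that $E(C_k)=2\cot\frac{\pi}{k}$ if $k\equiv0\pmod 4$, $2\csc\frac{\pi}{k}$ if $k\equiv 2\pmod 4$, $\csc\frac{\pi}{2k}$ if $k$ is odd; and $E(\boldsymbol C_k)=2\csc\frac{\pi}{k}$ if $k\equiv0\pmod 4$, $2\cot\frac{\pi}{k}$ if $k\equiv 2\pmod 4$, $\csc\frac{\pi}{2k}$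 if $k$ is odd. $\mathcal D_n^s$ is the class of sidigraphs on $n$ vertices whose underlying graph is connected and which contain exactly two directed cycles, these two cycles being vertex-disjoint (bicyclic vertex-disjoint sidigraphs). The energy of $S\in\mathcal D_n^s$ equals the sum of the energies of its two directed cycles. For integers $p,q\ge 2$ with $p+q\le n$, $D_n^s[p,q]$, $D_n^s[\boldsymbol p,\boldsymbol q]$, $D_n^s[\boldsymbol p,q]$, $D_n^s[p,\boldsymbol q]$ denote a member of $\mathcal D_n^s$ whose two directed cycles have lengths $p$ and $q$, where a bold entry indicates that the cycle of that length is negative and a non-bold entry that it is positive; its energy is e.g. $E(D_n^s[p,\boldsymbol q])=E(C_p)+E(\boldsymbol C_q)$. *)

theory Defs
  imports Complex_Main "Jordan_Normal_Form.Char_Poly"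
begin

text \<open>A signed digraph (sidigraph) on the vertex set {0..<n} is given by a sign function
  a :: nat => nat => int: a i j = 1 (resp. -1) if there is a positive (resp. negative)
  arc from vertex i to vertex j, and a i j = 0 if there is no arc. No loops.
  Entries outside {0..<n} are irrelevant and required to be 0.\<close>

definition sidigraph :: "nat \<Rightarrow> (nat \<Rightarrow> nat \<Rightarrow> int) \<Rightarrow> bool" where
  "sidigraph n a \<longleftrightarrow> (\<forall>i j. a i j \<in> {-1, 0, 1}) \<and> (\<forall>i. a i i = 0)
     \<and> (\<forall>i j. (i \<ge> n \<or> j \<ge> n) \<longrightarrow> a i j = 0)"

definition arcs :: "nat \<Rightarrow> (nat \<Rightarrow> nat \<Rightarrow> int) \<Rightarrow> (nat \<times> nat) set" where
  "arcs n a = {(i, j). i < n \<and> j < n \<and> a i j \<noteq> 0}"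

text \<open>The underlying (undirected) graph is connected.\<close>
definition underlying_connected :: "nat \<Rightarrow> (nat \<Rightarrow> nat \<Rightarrow> int) \<Rightarrow> bool" where
  "underlying_connected n a \<longleftrightarrow>
     (\<forall>i<n. \<forall>j<n. (i, j) \<in> (arcs n a \<union> (arcs n a)\<inverse>)\<^sup>*)"

text \<open>The arc set of the closed walk through the list of vertices vs (cyclically).\<close>
definition cycle_arcs :: "nat list \<Rightarrow> (nat \<times> nat) set" where
  "cycle_arcs vs = {(vs ! i, vs ! ((i + 1) mod length vs)) | i. i < length vs}"

text \<open>Directed cycles (of length at least 2), represented by their arc sets.\<close>
definition dcycles :: "nat \<Rightarrow> (nat \<Rightarrow> nat \<Rightarrow> int) \<Rightarrow> (nat \<times> nat) set set" where
  "dcycles n a = {cycle_arcs vs | vs. distinct vs \<and> length vs \<ge> 2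
                     \<and> cycle_arcs vs \<subseteq> arcs n a}"

definition cycle_vertices :: "(nat \<times> nat) set \<Rightarrow> nat set" where
  "cycle_vertices C = fst ` C"

definition cycle_length :: "(nat \<times> nat) set \<Rightarrow> nat" where
  "cycle_length C = card C"

text \<open>Sign of a directed cycle: product of the signs of its arcs.\<close>
definition cycle_sign :: "(nat \<Rightarrow> nat \<Rightarrow> int) \<Rightarrow> (nat \<times> nat) set \<Rightarrow> int" where
  "cycle_sign a C = (\<Prod>(i, j)\<in>C. a i j)"

text \<open>The class D_n^s: connected underlying graph, exactly two directed cycles,
  and these are vertex-disjoint.\<close>
definition bicyclic_vd :: "nat \<Rightarrow> (nat \<Rightarrow> nat \<Rightarrow> int) \<Rightarrow> bool" where
  "bicyclic_vd n a \<longleftrightarrow> sidigraph n a \<and> underlying_connected n a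
     \<and> card (dcycles n a) = 2
     \<and> (\<forall>C1\<in>dcycles n a. \<forall>C2\<in>dcycles n a. C1 \<noteq> C2 \<longrightarrow>
           cycle_vertices C1 \<inter> cycle_vertices C2 = {})"

text \<open>S is a D_n^s[p,q] with prescribed cycle signs sp, sq (sign -1 = bold entry).\<close>
definition has_cycle_type :: "nat \<Rightarrow> (nat \<Rightarrow> nat \<Rightarrow> int) \<Rightarrow> nat \<Rightarrow> int \<Rightarrow> nat \<Rightarrow> int \<Rightarrow> bool" where
  "has_cycle_type n a p sp q sq \<longleftrightarrow> bicyclic_vd n a \<and>
     (\<exists>C1\<in>dcycles n a. \<exists>C2\<in>dcycles n a. C1 \<noteq> C2
        \<and> cycle_length C1 = p \<and> cycle_sign a C1 = sp
        \<and> cycle_length C2 = q \<and> cycle_sign a C2 = sq)"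

definition adj_matrix :: "nat \<Rightarrow> (nat \<Rightarrow> nat \<Rightarrow> int) \<Rightarrow> complex mat" where
  "adj_matrix n a = mat n n (\<lambda>(i, j). of_int (a i j))"

text \<open>Energy: sum of |Re rho| over the eigenvalues rho of A(S), counted with
  (algebraic) multiplicity, i.e. over the roots of the characteristic polynomial.\<close>
definition energy :: "nat \<Rightarrow> (nat \<Rightarrow> nat \<Rightarrow> int) \<Rightarrow> real" where
  "energy n a = (let p = char_poly (adj_matrix n a) in
     (\<Sum>x\<in>{x. poly p x = 0}. real (order x p) * \<bar>Re x\<bar>))"

definition even_cycles :: "nat \<Rightarrow> (nat \<Rightarrow> nat \<Rightarrow> int) \<Rightarrow> bool" where
  "even_cycles n a \<longleftrightarrow> (\<forall>C\<in>dcycles n a. even (cycle_length C))"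

text \<open>T attains the maximal (resp. minimal) energy among the members of D_n^s
  whose directed cycles both have even length.\<close>
definition max_even :: "nat \<Rightarrow> (nat \<Rightarrow> nat \<Rightarrow> int) \<Rightarrow> bool" where
  "max_even n t \<longleftrightarrow> bicyclic_vd n t \<and> even_cycles n t \<and>
     (\<forall>s. bicyclic_vd n s \<and> even_cycles n s \<longrightarrow> energy n s \<le> energy n t)"

definition min_even :: "nat \<Rightarrow> (nat \<Rightarrow> nat \<Rightarrow> int) \<Rightarrow> bool" where
  "min_even n t \<longleftrightarrow> bicyclic_vd n t \<and> even_cycles n t \<and>
     (\<forall>s. bicyclic_vd n s \<and> even_cycles n s \<longrightarrow> energy n t \<le> energy n s)"

end

theory Submission
  imports Defs "HOL-Combinatorics.Cycles"
begin

text \<open>In the Leibniz expansion of the characteristic polynomial only the permutations built from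
  the two disjoint cycles contribute, so it equals \<open>x\<^sup>r (x\<^sup>p - s) (x\<^sup>q - t)\<close> with \<open>p\<close>, \<open>q\<close> the
  lengths and \<open>s\<close>, \<open>t\<close> the signs of the cycles. For even \<open>p\<close> the factor \<open>x\<^sup>p - s\<close> contributes at most
  \<open>2 csc (\<pi>/p)\<close> to the energy, with equality for one of the two signs, and
  \<open>csc (\<pi>/p) + csc (\<pi>/q)\<close> with \<open>p + q\<close> bounded is largest when \<open>p = 2\<close>.\<close>

subsection \<open>Cycles as permutations\<close>

text \<open>Energy is defined through eigenvalues with multiplicity, so both its additivity over the
  two cycles and the value for a single cycle have to be extracted from the factorisation of the
  characteristic polynomial. For length \<open>2 * m\<close> the sign that reaches the cosecant is
  \<open>(-1) ^ Suc m\<close>. This one rule decides which entries are bold: the 2-cycle must be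
  positive (\<open>m = 1\<close>), and the other cycle must be positive exactly when its length is 2
  modulo 4. Two even lengths have an even sum, so for odd n at least one vertex lies off the cycles
  and the second length drops to n - 3. The cosecant inequality is obtained without convexity, from
  the linear bounds \<open>x / pi\<close> and \<open>x / pi + 1 / 6\<close>; these are coarse enough
  that 3 \<le> pi \<le> 33/10 is all that has to be known about pi. The minimum requires no
  comparison of cosecants: a negative 2-cycle has eigenvalues i and -i, so two of them give energy
  0.\<close>

lemma cycle_of_list_nth:
  assumes "distinct vs" "i < length vs"
  shows "cycle_of_list vs (vs ! i) = vs ! ((i + 1) mod length vs)"
proof -
  have "map (cycle_of_list vs) vs = rotate1 vs"
    using cyclic_rotation[OF assms(1), of 1] by simp
  then have "map (cycle_of_list vs) vs ! i = rotate1 vs ! i" by simp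
  with assms(2) show ?thesis by (simp add: nth_rotate1)
qed

lemma cycle_arcs_eq_imageI:
  assumes "\<And>i. i < length vs \<Longrightarrow> vs ! ((i + 1) mod length vs) = f (vs ! i)"
  shows "cycle_arcs vs = (\<lambda>v. (v, f v)) ` set vs"
  unfolding cycle_arcs_def using assms by (fastforce simp: set_conv_nth image_iff)

lemma cycle_arcs_eq_image:
  "distinct vs \<Longrightarrow> cycle_arcs vs = (\<lambda>v. (v, cycle_of_list vs v)) ` set vs"
  by (rule cycle_arcs_eq_imageI) (simp add: cycle_of_list_nth)

lemma cycle_vertices_cycle_arcs:
  "distinct vs \<Longrightarrow> cycle_vertices (cycle_arcs vs) = set vs"
  by (simp add: cycle_vertices_def cycle_arcs_eq_image image_image)

lemma cycle_length_cycle_arcs: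
  "distinct vs \<Longrightarrow> cycle_length (cycle_arcs vs) = length vs"
  by (simp add: cycle_length_def cycle_arcs_eq_image card_image inj_on_def distinct_card)

lemma cycle_sign_cycle_arcs:
  "distinct vs \<Longrightarrow> cycle_sign a (cycle_arcs vs) = (\<Prod>v\<in>set vs. a v (cycle_of_list vs v))"
  by (simp add: cycle_sign_def cycle_arcs_eq_image prod.reindex inj_on_def)

lemma cycle_of_list_neq:
  assumes "distinct vs" "length vs \<ge> 2" "v \<in> set vs"
  shows "cycle_of_list vs v \<noteq> v"
proof -
  from assms(3) obtain i where i: "i < length vs" "v = vs ! i" by (auto simp: set_conv_nth)
  have "(i + 1) mod length vs \<noteq> i"
    using i(1) assms(2) by (cases "i + 1 = length vs") auto
  then show ?thesis
    using i assms(1,2) cycle_of_list_nth[OF assms(1) i(1)]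
    by (metis gr_implies_not0 length_0_conv length_greater_0_conv mod_less_divisor nth_eq_iff_index_eq)
qed

lemma sign_cycle_of_list:
  "distinct vs \<Longrightarrow> sign (cycle_of_list vs) = (- 1) ^ (length vs - 1)"
proof (induction vs rule: cycle_of_list.induct)
  case (1 i j cs)
  have "sign (cycle_of_list (i # j # cs)) = sign (transpose i j) * sign (cycle_of_list (j # cs))"
    unfolding cycle_of_list.simps by (intro sign_compose permutation_swap_id permutation_of_cycle)
  with 1 show ?case by (simp add: sign_swap_id del: cycle_of_list.simps)
qed simp_all

lemma dcyclesE:
  assumes "C \<in> dcycles n a"
  obtains vs where "distinct vs" "length vs \<ge> 2" "C = cycle_arcs vs" "set vs \<subseteq> {0..<n}"
    "\<And>v. v \<in> set vs \<Longrightarrow> cycle_of_list vs v < n \<and> a v (cycle_of_list vs v) \<noteq> 0"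
proof -
  from assms obtain vs where vs: "distinct vs" "length vs \<ge> 2" "C = cycle_arcs vs"
    "cycle_arcs vs \<subseteq> arcs n a" by (auto simp: dcycles_def)
  show ?thesis
    by (rule that[OF vs(1-3)]) (use vs(4) in \<open>auto simp: cycle_arcs_eq_image[OF vs(1)] arcs_def\<close>)
qed

text \<open>A nonzero Leibniz term belongs to a permutation that moves vertices only along arcs.
  Following such a permutation from a moved vertex until it returns traces a directed cycle, which
  ties permutations to \<open>dcycles\<close>.\<close>

lemma support_in_dcycles:
  assumes "\<pi> permutes {0..<n}" and arc: "\<And>i. i < n \<Longrightarrow> \<pi> i \<noteq> i \<Longrightarrow> a i (\<pi> i) \<noteq> 0"
    and "\<pi> v \<noteq> v"
  shows "cycle_arcs (support \<pi> v) = (\<lambda>u. (u, \<pi> u)) ` set (support \<pi> v)"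
    and "v \<in> set (support \<pi> v)"
    and "cycle_arcs (support \<pi> v) \<in> dcycles n a"
proof -
  let ?s = "support \<pi> v"
  have perm: "permutation \<pi>" using assms(1) permutation_permutes by blast
  note lp = least_power_of_permutation[OF perm, of v]
  have gt: "least_power \<pi> v > 1" using least_power_gt_one[OF perm assms(3)] by simp
  have d: "distinct ?s" using cycle_of_permutation[OF perm] .
  have step: "?s ! ((i + 1) mod length ?s) = \<pi> (?s ! i)" if "i < length ?s" for i
  proof (cases "i + 1 = least_power \<pi> v")
    case True
    then have "\<pi> ((\<pi> ^^ i) v) = v" using lp(1) by (metis Suc_eq_plus1 comp_apply funpow.simps(2))
    with True gt show ?thesis by simp
  qed (use that in auto)
  show im: "cycle_arcs ?s = (\<lambda>u. (u, \<pi> u)) ` set ?s"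
    by (rule cycle_arcs_eq_imageI) (rule step)
  show "v \<in> set ?s" using lp(2) by force
  have "u < n \<and> \<pi> u < n \<and> a u (\<pi> u) \<noteq> 0" if "u \<in> set ?s" for u
  proof -
    from that obtain i where u: "u = (\<pi> ^^ i) v" by auto
    \<comment> \<open>A fixed point anywhere on the orbit would, by injectivity of
      \<open>\<pi> ^^ i\<close>, make \<open>v\<close> itself fixed.\<close>
    have "bij \<pi>" using perm permutation_bijective by blast
    have "\<pi> ((\<pi> ^^ i) v) = (\<pi> ^^ i) (\<pi> v)" by (simp add: funpow_swap1)
    moreover have "inj (\<pi> ^^ i)" using \<open>bij \<pi>\<close> by (simp add: bij_is_inj inj_fn)
    ultimately have ne: "\<pi> u \<noteq> u" using assms(3) u by (simp add: inj_eq)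
    then have "u < n" using assms(1) by (auto simp: permutes_def)
    then show ?thesis using arc ne permutes_in_image[OF assms(1)] by auto
  qed
  then have "cycle_arcs ?s \<subseteq> arcs n a" by (auto simp: im arcs_def)
  with d gt show "cycle_arcs ?s \<in> dcycles n a" unfolding dcycles_def by fastforce
qed

text \<open>If a permutation along the arcs moves one vertex of a cycle disjoint from all other
  cycles, the orbit of that vertex can only be this cycle.\<close>
lemma permutes_agrees_on_cycle:
  assumes "\<pi> permutes {0..<n}" "\<And>i. i < n \<Longrightarrow> \<pi> i \<noteq> i \<Longrightarrow> a i (\<pi> i) \<noteq> 0"
    and disj: "\<And>C. C \<in> dcycles n a \<Longrightarrow> C \<noteq> cycle_arcs vs \<Longrightarrow> cycle_vertices C \<inter> set vs = {}"
    and vs: "distinct vs" and u: "u \<in> set vs" "\<pi> u \<noteq> u" and v: "v \<in> set vs"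
  shows "\<pi> v = cycle_of_list vs v"
proof -
  note s = support_in_dcycles[where a = a, OF assms(1,2) u(2)]
  have "u \<in> cycle_vertices (cycle_arcs (support \<pi> u))"
    using s(1,2) by (simp add: cycle_vertices_def image_image)
  then have "cycle_arcs (support \<pi> u) = cycle_arcs vs" using disj[OF s(3)] u(1) by blast
  then have "(v, cycle_of_list vs v) \<in> cycle_arcs (support \<pi> u)"
    using v vs by (simp add: cycle_arcs_eq_image)
  then show ?thesis by (auto simp: s(1))
qed

subsection \<open>The characteristic polynomial\<close>

lemma char_poly_matrix_adj_nth:
  assumes "i < n" "j < n"
  shows "char_poly_matrix (adj_matrix n a) $$ (i, j) =
    (if i = j then [:0, 1:] else 0) + [:- of_int (a i j):]"
  using assms by (simp add: char_poly_matrix_def adj_matrix_def)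

text \<open>On each of two disjoint sets there is one binary choice, and everything else is fixed,
  so the two choices leave four maps.\<close>

lemma permutes_preserving_cases:
  fixes f g :: "'a \<Rightarrow> 'a"
  assumes "V1 \<inter> V2 = {}"
    and f: "\<And>v. v \<notin> V1 \<Longrightarrow> f v = v" and g: "\<And>v. v \<notin> V2 \<Longrightarrow> g v = v"
    and f1: "\<And>v. v \<in> V1 \<Longrightarrow> f v \<in> V1" and g2: "\<And>v. v \<in> V2 \<Longrightarrow> g v \<in> V2"
    and p: "\<And>v. v \<notin> V1 \<Longrightarrow> v \<notin> V2 \<Longrightarrow> p v = v"
    and p1: "(\<forall>v\<in>V1. p v = v) \<or> (\<forall>v\<in>V1. p v = f v)"
    and p2: "(\<forall>v\<in>V2. p v = v) \<or> (\<forall>v\<in>V2. p v = g v)"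
  shows "p \<in> {id, f, g, f \<circ> g}"
proof -
  consider "\<forall>v\<in>V1. p v = v" "\<forall>v\<in>V2. p v = v" | "\<forall>v\<in>V1. p v = f v" "\<forall>v\<in>V2. p v = v"
    | "\<forall>v\<in>V1. p v = v" "\<forall>v\<in>V2. p v = g v" | "\<forall>v\<in>V1. p v = f v" "\<forall>v\<in>V2. p v = g v"
    using p1 p2 by blast
  then show ?thesis
  proof cases
    case 1
    then have "p = id" using p by (metis eq_id_iff)
    then show ?thesis by simp
  next
    case 2
    then have "p = f" using p f by (metis ext)
    then show ?thesis by simp
  next
    case 3
    then have "p = g" using p g by (metis ext)
    then show ?thesis by simp
  next
    case 4
    have "p v = (f \<circ> g) v" for v
      using 4 p[of v] f[of v] g[of v] f[of "g v"] g2[of v] disjoint_iff[of V1 V2] assms(1)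
      by (cases "v \<in> V1"; cases "v \<in> V2") (simp_all, metis+)
    then have "p = f \<circ> g" by (rule ext)
    then show ?thesis by simp
  qed
qed

text \<open>The four surviving Leibniz terms are the four terms of the expanded product: fixing a
  cycle pointwise contributes a power of x, rotating it contributes minus its sign, and each vertex
  off both cycles contributes a factor x.\<close>

lemma char_poly_two_disjoint_cycles:
  assumes diag: "\<And>i. a i i = 0"
    and dc: "dcycles n a = {cycle_arcs vs, cycle_arcs ws}"
    and vs: "distinct vs" "length vs \<ge> 2" and ws: "distinct ws" "length ws \<ge> 2"
    and disj: "set vs \<inter> set ws = {}"
  shows "char_poly (adj_matrix n a) = monom 1 (n - length vs - length ws) *
      (monom 1 (length vs) - [:of_int (cycle_sign a (cycle_arcs vs)):]) *
      (monom 1 (length ws) - [:of_int (cycle_sign a (cycle_arcs ws)):])"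
proof -
  define V where "V = set vs"
  define W where "W = set ws"
  define f where "f = cycle_of_list vs"
  define g where "g = cycle_of_list ws"
  have finVW [simp]: "finite V" "finite W" by (simp_all add: V_def W_def)
  have disj': "V \<inter> W = {}" using disj by (simp add: V_def W_def)
  have cardV: "card V = length vs" and cardW: "card W = length ws"
    using vs ws by (simp_all add: V_def W_def distinct_card)
  have fp: "f permutes V" and gp: "g permutes W"
    by (simp_all add: f_def g_def V_def W_def cycle_permutes)
  have fV: "f v \<in> V \<longleftrightarrow> v \<in> V" and gW: "g v \<in> W \<longleftrightarrow> v \<in> W" for v
    using permutes_in_image[OF fp] permutes_in_image[OF gp] by auto
  have fo: "f v = v" if "v \<notin> V" for v using that fp by (auto simp: permutes_def)
  have go: "g v = v" if "v \<notin> W" for v using that gp by (auto simp: permutes_def)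
  have fV_ne: "f v \<noteq> v" if "v \<in> V" for v using that cycle_of_list_neq[OF vs] by (simp add: V_def f_def)
  have gW_ne: "g v \<noteq> v" if "v \<in> W" for v using that cycle_of_list_neq[OF ws] by (simp add: W_def g_def)
  have arcsV: "cycle_arcs vs = (\<lambda>v. (v, f v)) ` V" and arcsW: "cycle_arcs ws = (\<lambda>v. (v, g v)) ` W"
    using vs ws by (simp_all add: cycle_arcs_eq_image f_def g_def V_def W_def)
  have arc: "v < n \<and> f v < n \<and> a v (f v) \<noteq> 0" if "v \<in> V" for v
  proof -
    from dc have "cycle_arcs vs \<in> dcycles n a" by simp
    then have "cycle_arcs vs \<subseteq> arcs n a" by (auto simp: dcycles_def)
    with that arcsV show ?thesis by (auto simp: arcs_def)
  qed
  have arcW: "v < n \<and> g v < n \<and> a v (g v) \<noteq> 0" if "v \<in> W" for v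
  proof -
    from dc have "cycle_arcs ws \<in> dcycles n a" by simp
    then have "cycle_arcs ws \<subseteq> arcs n a" by (auto simp: dcycles_def)
    with that arcsW show ?thesis by (auto simp: arcs_def)
  qed
  have sub: "set vs \<union> set ws \<subseteq> {0..<n}"
    using arc arcW by (auto simp: V_def W_def)
  define R where "R = {0..<n} - V - W"
  have VW_sub: "V \<subseteq> {0..<n}" "W \<subseteq> {0..<n}" using sub by (auto simp: V_def W_def)
  have cardR: "card R = n - length vs - length ws"
  proof -
    have "W \<subseteq> {0..<n} - V" using VW_sub disj' by auto
    then show ?thesis using VW_sub by (simp add: R_def card_Diff_subset cardV cardW)
  qed
  define M where "M = char_poly_matrix (adj_matrix n a)"
  have M: "M $$ (i, j) = (if i = j then [:0, 1:] else [:- of_int (a i j):])" if "i < n" "j < n" for i j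
    using that diag by (simp add: M_def char_poly_matrix_adj_nth)
  define T where "T \<pi> = signof \<pi> * (\<Prod>i = 0..<n. M $$ (i, \<pi> i))" for \<pi>
  let ?P = "{\<pi>. \<pi> permutes {0..<n}}"
  let ?F = "{id, f, g, f \<circ> g}"
  have Msq: "M \<in> carrier_mat n n"
    unfolding M_def by (rule char_poly_matrix_closed) (simp add: adj_matrix_def)
  have fn: "f permutes {0..<n}" and gn: "g permutes {0..<n}"
    using permutes_subset[OF fp VW_sub(1)] permutes_subset[OF gp VW_sub(2)] .
  then have FP: "?F \<subseteq> ?P" by (auto intro: permutes_compose permutes_id)
  have Fcases: "\<pi> \<in> ?F" if "\<pi> \<in> ?P" "T \<pi> \<noteq> 0" for \<pi>
  proof -
    have \<pi>: "\<pi> permutes {0..<n}" using that(1) by simp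
    \<comment> \<open>Off the diagonal the entry is \<open>- a i j\<close>, so a single missing arc
      would annihilate the whole term.\<close>
    have nz: "a i (\<pi> i) \<noteq> 0" if "i < n" "\<pi> i \<noteq> i" for i
    proof
      assume "a i (\<pi> i) = 0"
      moreover have "\<pi> i < n" using permutes_in_image[OF \<pi>, of i] \<open>i < n\<close> by simp
      ultimately have "M $$ (i, \<pi> i) = 0" using M that by simp
      then have "(\<Prod>i = 0..<n. M $$ (i, \<pi> i)) = 0" using \<open>i < n\<close> by (intro prod_zero) auto
      with \<open>T \<pi> \<noteq> 0\<close> show False by (simp add: T_def)
    qed
    have agV: "\<pi> v = f v" if "u \<in> V" "\<pi> u \<noteq> u" "v \<in> V" for u v
      unfolding f_def
      by (rule permutes_agrees_on_cycle[where a = a and n = n and u = u])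
        (use that \<pi> nz dc disj vs ws in \<open>auto simp: V_def cycle_vertices_cycle_arcs\<close>)
    have agW: "\<pi> v = g v" if "u \<in> W" "\<pi> u \<noteq> u" "v \<in> W" for u v
      unfolding g_def
      by (rule permutes_agrees_on_cycle[where a = a and n = n and u = u])
        (use that \<pi> nz dc disj vs ws in \<open>auto simp: W_def cycle_vertices_cycle_arcs\<close>)
    have out: "\<pi> v = v" if "v \<notin> V" "v \<notin> W" for v
    proof (rule ccontr)
      assume ne: "\<pi> v \<noteq> v"
      note s = support_in_dcycles[where a = a, OF \<pi> nz ne]
      have "v \<in> cycle_vertices (cycle_arcs (support \<pi> v))"
        using s(1,2) by (simp add: cycle_vertices_def image_image)
      with s(3) that show False
        using vs ws by (auto simp: dc V_def W_def cycle_vertices_cycle_arcs)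
    qed
    show ?thesis
    proof (rule permutes_preserving_cases[OF disj'])
      show "(\<forall>v\<in>V. \<pi> v = v) \<or> (\<forall>v\<in>V. \<pi> v = f v)" using agV by metis
      show "(\<forall>v\<in>W. \<pi> v = v) \<or> (\<forall>v\<in>W. \<pi> v = g v)" using agW by metis
    qed (simp_all add: fo go fV gW out)
  qed
  have "det M = (\<Sum>\<pi>\<in>?P. T \<pi>)"
    unfolding det_def'[OF Msq] T_def ..
  also have "\<dots> = (\<Sum>\<pi>\<in>?F. T \<pi>)"
    by (rule sum.mono_neutral_right) (use FP Fcases finite_permutations[of "{0..<n}"] in auto)
  finally have det: "det M = (\<Sum>\<pi>\<in>?F. T \<pi>)" .
  \<comment> \<open>One vertex on each cycle suffices to tell the four permutations apart; without
    distinctness the sum over the set would not split into four summands.\<close>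
  from vs obtain v where v: "v \<in> V" by (cases vs) (auto simp: V_def)
  from ws obtain w where w: "w \<in> W" by (cases ws) (auto simp: W_def)
  have "v \<notin> W" "w \<notin> V" using v w disj' by auto
  have neq: "h \<noteq> k" if "h x \<noteq> k x" for h k :: "nat \<Rightarrow> nat" and x
    using that by auto
  have at_v: "f v \<noteq> v" "g v = v" and at_w: "f w = w" "g w \<noteq> w"
    using v w fV_ne gW_ne fo go \<open>v \<notin> W\<close> \<open>w \<notin> V\<close> by simp_all
  have fog: "f (g x) = g x" if "x \<in> W" for x
    using that gW disj' fo by (metis disjoint_iff)
  have dist: "id \<noteq> f" "id \<noteq> g" "id \<noteq> f \<circ> g" "f \<noteq> g" "f \<noteq> f \<circ> g" "g \<noteq> f \<circ> g"
    using at_v at_w fog[OF w] neq[of id v f] neq[of id w g] neq[of id v "f \<circ> g"]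
      neq[of f v g] neq[of f w "f \<circ> g"] neq[of g v "f \<circ> g"] by simp_all
  have split: "T \<pi> = signof \<pi> * ((\<Prod>i\<in>V. M $$ (i, \<pi> i)) * (\<Prod>i\<in>W. M $$ (i, \<pi> i)) * (\<Prod>i\<in>R. M $$ (i, \<pi> i)))"
    for \<pi>
  proof -
    have "{0..<n} = (V \<union> W) \<union> R" using VW_sub by (auto simp: R_def)
    moreover have "(V \<union> W) \<inter> R = {}" "finite R" by (auto simp: R_def)
    ultimately show ?thesis
      unfolding T_def using disj' by (simp only: prod.union_disjoint finite_Un finVW simp_thms)
  qed
  have fixed: "(\<Prod>i\<in>A. M $$ (i, \<pi> i)) = monom 1 (card A)" if "\<And>i. i \<in> A \<Longrightarrow> \<pi> i = i" "A \<subseteq> {0..<n}" for A \<pi>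
  proof -
    have "(\<Prod>i\<in>A. M $$ (i, \<pi> i)) = (\<Prod>i\<in>A. monom 1 1)"
      by (rule prod.cong) (use that in \<open>auto simp: M monom_altdef\<close>)
    also have "\<dots> = monom 1 (card A)" by (simp add: monom_power)
    finally show ?thesis .
  qed
  \<comment> \<open>A rotation of k vertices has sign \<open>(-1) ^ (k - 1)\<close> and its k matrix
    entries carry k more minus signs, so exactly one minus sign remains whatever the parity of
    k.\<close>
  have rot: "of_int (sign h) * (\<Prod>i\<in>A. M $$ (i, h i)) = - [:of_int (\<Prod>v\<in>A. a v (h v)):]"
    if "\<And>i. i \<in> A \<Longrightarrow> i \<noteq> h i \<and> i < n \<and> h i < n" "sign h = (-1) ^ (card A - 1)" "card A > 0"
    for A and h :: "nat \<Rightarrow> nat"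
  proof -
    have "(\<Prod>i\<in>A. M $$ (i, h i)) = (\<Prod>i\<in>A. - of_int (a i (h i)))"
      by (rule prod.cong) (use that(1) M in \<open>auto simp: of_int_poly\<close>)
    also have "\<dots> = (- 1) ^ card A * of_int (\<Prod>i\<in>A. a i (h i))"
      by (simp add: prod_uminus)
    finally have "of_int (sign h) * (\<Prod>i\<in>A. M $$ (i, h i)) =
      (- 1) ^ (card A - 1) * (- 1) ^ Suc (card A - 1) * of_int (\<Prod>i\<in>A. a i (h i))"
      using that(2,3) by simp
    also have "\<dots> = - of_int (\<Prod>i\<in>A. a i (h i))" by (simp flip: power_mult_distrib)
    finally show ?thesis by (simp add: of_int_poly)
  qed
  define s where "s = cycle_sign a (cycle_arcs vs)"
  define t where "t = cycle_sign a (cycle_arcs ws)"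
  have sgf: "sign f = (-1) ^ (card V - 1)" and sgg: "sign g = (-1) ^ (card W - 1)"
    using vs ws by (simp_all add: f_def g_def cardV cardW sign_cycle_of_list)
  have rotV: "of_int (sign f) * (\<Prod>i\<in>V. M $$ (i, f i)) = - [:of_int s:]"
    unfolding s_def cycle_sign_cycle_arcs[OF vs(1)] V_def[symmetric] f_def[symmetric]
    by (rule rot) (use fV_ne[symmetric] arc sgf vs cardV in auto)
  have rotW: "of_int (sign g) * (\<Prod>i\<in>W. M $$ (i, g i)) = - [:of_int t:]"
    unfolding t_def cycle_sign_cycle_arcs[OF ws(1)] W_def[symmetric] g_def[symmetric]
    by (rule rot) (use gW_ne[symmetric] arcW sgg ws cardW in auto)
  have perm: "permutation f" "permutation g" by (simp_all add: f_def g_def permutation_of_cycle)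
  let ?X = "\<lambda>k. monom (1::complex) k"
  have Rsub: "R \<subseteq> {0..<n}" by (auto simp: R_def)
  have Tid: "T id = ?X (card V) * ?X (card W) * ?X (card R)"
    unfolding split using VW_sub Rsub by (simp add: fixed)
  have Tf: "T f = - [:of_int s:] * ?X (card W) * ?X (card R)"
  proof -
    have "(\<Prod>i\<in>W. M $$ (i, f i)) = ?X (card W)" "(\<Prod>i\<in>R. M $$ (i, f i)) = ?X (card R)"
      by (rule fixed; use disj' VW_sub fo in \<open>auto simp: R_def\<close>)+
    then show ?thesis unfolding split rotV[symmetric] by (simp add: mult_ac)
  qed
  have Tg: "T g = ?X (card V) * - [:of_int t:] * ?X (card R)"
  proof -
    have "(\<Prod>i\<in>V. M $$ (i, g i)) = ?X (card V)" "(\<Prod>i\<in>R. M $$ (i, g i)) = ?X (card R)"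
      by (rule fixed; use disj' VW_sub go in \<open>auto simp: R_def\<close>)+
    then show ?thesis unfolding split rotW[symmetric] by (simp add: mult_ac)
  qed
  have Tfg: "T (f \<circ> g) = - [:of_int s:] * - [:of_int t:] * ?X (card R)"
  proof -
    have "(\<Prod>i\<in>R. M $$ (i, (f \<circ> g) i)) = ?X (card R)"
      by (rule fixed; use disj' VW_sub go fo in \<open>auto simp: R_def\<close>)
    moreover have "(\<Prod>i\<in>V. M $$ (i, (f \<circ> g) i)) = (\<Prod>i\<in>V. M $$ (i, f i))"
      by (rule prod.cong) (use disj' go in \<open>auto simp: disjoint_iff\<close>)
    moreover have "(\<Prod>i\<in>W. M $$ (i, (f \<circ> g) i)) = (\<Prod>i\<in>W. M $$ (i, g i))"
      by (rule prod.cong) (use fog in auto)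
    ultimately show ?thesis
      unfolding split rotV[symmetric] rotW[symmetric] sign_compose[OF perm] by (simp add: mult_ac)
  qed
  have "char_poly (adj_matrix n a) = T id + T f + T g + T (f \<circ> g)"
    using dist by (simp add: char_poly_def det flip: M_def)
  also have "\<dots> = ?X (card R) * (?X (card V) - [:of_int s:]) * (?X (card W) - [:of_int t:])"
  proof -
    have "x * y * r + - b * y * r + x * - c * r + - b * - c * r = r * (x - b) * (y - c)"
      for x y r b c :: "complex poly" by (simp add: algebra_simps)
    then show ?thesis unfolding Tid Tf Tg Tfg .
  qed
  finally show "char_poly (adj_matrix n a) = monom 1 (n - length vs - length ws) *
      (monom 1 (length vs) - [:of_int (cycle_sign a (cycle_arcs vs)):]) *
      (monom 1 (length ws) - [:of_int (cycle_sign a (cycle_arcs ws)):])"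
    by (simp only: cardR cardV cardW s_def t_def)
qed

subsection \<open>Energy of a polynomial with known roots\<close>

lemma sum_mset_eq_sum_count:
  fixes f :: "'a \<Rightarrow> 'b :: comm_semiring_1"
  assumes "finite A" "set_mset M \<subseteq> A"
  shows "(\<Sum>x\<in>#M. f x) = (\<Sum>x\<in>A. of_nat (count M x) * f x)"
  using assms(2)
proof (induction M)
  case (add x M)
  have "(\<Sum>y\<in>A. of_nat (count (add_mset x M) y) * f y) =
      (\<Sum>y\<in>A. of_nat (count M y) * f y + (if y = x then f y else 0))"
    by (rule sum.cong) (auto simp: algebra_simps)
  also have "\<dots> = (\<Sum>y\<in>A. of_nat (count M y) * f y) + f x"
    using add.prems assms(1) by (simp add: sum.distrib)
  finally show ?case using add by (simp add: add.commute)
qed simp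

text \<open>Summing over the multiset of roots makes additivity under products immediate; the sum
  weighted by \<open>order\<close> over a root set, as in \<open>energy\<close>, does not.\<close>

definition poly_energy :: "complex poly \<Rightarrow> real" where
  "poly_energy p = (\<Sum>x\<in>#proots p. \<bar>Re x\<bar>)"

lemma energy_eq_poly_energy: "energy n a = poly_energy (char_poly (adj_matrix n a))"
proof -
  let ?p = "char_poly (adj_matrix n a)"
  have "?p \<noteq> 0"
    using degree_monic_char_poly[of "adj_matrix n a" n] by (auto simp: adj_matrix_def)
  then show ?thesis
    by (simp add: energy_def poly_energy_def Let_def poly_roots_finite
        sum_mset_eq_sum_count[of "{x. poly ?p x = 0}"])
qed

lemma poly_energy_mult:
  "p \<noteq> 0 \<Longrightarrow> q \<noteq> 0 \<Longrightarrow> poly_energy (p * q) = poly_energy p + poly_energy q"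
  by (simp add: poly_energy_def proots_mult)

lemma poly_energy_monom: "poly_energy (monom 1 k) = 0"
proof -
  have "proots (monom (1::complex) k) = replicate_mset k 0"
    by (simp add: monom_altdef proots_power)
  then show ?thesis by (simp add: poly_energy_def)
qed

text \<open>The derivative vanishes at most at 0, which is not a root as
  \<open>c \<noteq> 0\<close>. Hence all roots are simple and multiplicities disappear from the
  sum.\<close>

lemma poly_energy_nth_roots:
  fixes c :: complex
  assumes "k > 0" "c \<noteq> 0"
  shows "monom 1 k - [:c:] \<noteq> 0" "poly_energy (monom 1 k - [:c:]) = (\<Sum>z | z ^ k = c. \<bar>Re z\<bar>)"
proof -
  let ?p = "monom 1 k - [:c:]"
  have "poly ?p 0 \<noteq> 0" using assms by (simp add: poly_monom power_0_left)
  then show ne: "?p \<noteq> 0" by auto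
  have roots: "{x. poly ?p x = 0} = {z. z ^ k = c}" by (simp add: poly_monom)
  have "poly (pderiv ?p) x \<noteq> 0" if "poly ?p x = 0" for x
    using that assms by (auto simp: poly_monom pderiv_diff pderiv_monom pderiv_pCons)
  then have "rsquarefree ?p" unfolding rsquarefree_roots by blast
  then have "order x ?p = 1" if "poly ?p x = 0" for x
    using that ne by (metis order_root rsquarefree_def)
  then have "proots ?p = mset_set {z. z ^ k = c}"
    using ne assms finite_nth_roots[of k c]
    by (intro multiset_eqI) (auto simp: count_mset_set' order_0I poly_monom)
  then show "poly_energy ?p = (\<Sum>z | z ^ k = c. \<bar>Re z\<bar>)"
    by (simp add: poly_energy_def sum_unfold_sum_mset)
qed

section \<open>Sums of absolute real parts over the roots of a unit complex number\<close>

lemma nth_roots_cis: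
  assumes "k > 0" "cis \<alpha> ^ k = c"
  shows "bij_betw (\<lambda>j. cis (\<alpha> + 2 * pi * real j / real k)) {..<k} {z. z ^ k = c}"
proof -
  have "bij_betw (\<lambda>z. cis \<alpha> * z) {z. z ^ k = 1} {z. z ^ k = c}"
    by (rule bij_betwI[where g = "\<lambda>z. z / cis \<alpha>"]) (use assms in \<open>auto simp: power_mult_distrib power_divide\<close>)
  from bij_betw_trans[OF bij_betw_roots_unity[OF assms(1)] this] show ?thesis
    by (simp add: comp_def cis_mult)
qed

text \<open>Starting from the angle \<open>\<alpha>\<close>, the first half of the roots lies in the right half-plane
  and the second half is its negative.\<close>
lemma sum_abs_Re_nth_roots:
  assumes "m > 0" "cis \<alpha> ^ (2 * m) = c"
    and \<alpha>: "- (pi / 2) \<le> \<alpha>" "\<alpha> + pi * (real m - 1) / m \<le> pi / 2"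
  shows "(\<Sum>z | z ^ (2 * m) = c. \<bar>Re z\<bar>) = - (2 * sin (\<alpha> - pi / (2 * m))) / sin (pi / (2 * m))"
proof -
  have split: "(\<Sum>j<k + l. f j) = (\<Sum>j<k. f j) + (\<Sum>j<l. f (k + j))" for k l and f :: "nat \<Rightarrow> real"
    by (induction l) (simp_all add: add.assoc)
  define \<theta> where "\<theta> j = \<alpha> + pi * real j / m" for j
  have "(\<Sum>z | z ^ (2 * m) = c. \<bar>Re z\<bar>) = (\<Sum>j<2*m. \<bar>Re (cis (\<alpha> + 2 * pi * real j / real (2 * m)))\<bar>)"
    by (rule sum.reindex_bij_betw[OF nth_roots_cis, symmetric]) (use assms in auto)
  also have "\<dots> = (\<Sum>j<m + m. \<bar>cos (\<theta> j)\<bar>)"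
    using assms(1) by (intro sum.cong) (auto simp: \<theta>_def)
  also have "\<dots> = (\<Sum>j<m. \<bar>cos (\<theta> j)\<bar>) + (\<Sum>j<m. \<bar>cos (\<theta> (m + j))\<bar>)"
    by (rule split)
  also have "(\<Sum>j<m. \<bar>cos (\<theta> (m + j))\<bar>) = (\<Sum>j<m. \<bar>cos (\<theta> j)\<bar>)"
  proof (rule sum.cong)
    fix j
    have "\<theta> (m + j) = \<theta> j + pi" using assms(1) by (simp add: \<theta>_def distrib_left add_divide_distrib)
    then show "\<bar>cos (\<theta> (m + j))\<bar> = \<bar>cos (\<theta> j)\<bar>" by simp
  qed simp
  also have "(\<Sum>j<m. \<bar>cos (\<theta> j)\<bar>) = (\<Sum>j<m. cos (\<theta> j))"
  proof (rule sum.cong)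
    fix j assume "j \<in> {..<m}"
    then have "real j \<le> real m - 1" by auto
    then have "\<theta> j \<le> \<alpha> + pi * (real m - 1) / m"
      unfolding \<theta>_def by (intro add_left_mono divide_right_mono mult_left_mono) auto
    then have "\<theta> j \<le> pi / 2" using \<alpha>(2) by (rule order_trans)
    moreover have "- (pi / 2) \<le> \<theta> j" unfolding \<theta>_def using \<alpha>(1) by (intro add_increasing2) auto
    ultimately show "\<bar>cos (\<theta> j)\<bar> = cos (\<theta> j)" by (simp add: cos_ge_zero)
  qed simp
  finally have sum: "(\<Sum>z | z ^ (2 * m) = c. \<bar>Re z\<bar>) = 2 * (\<Sum>j<m. cos (\<theta> j))" by simp
  \<comment> \<open>This is half the angular step, so that
    \<open>2 * sin h * cos (\<theta> j)\<close> becomes a difference of sines and the sum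
    telescopes.\<close>
  define h where "h = pi / (2 * m)"
  have "h \<le> pi / 2" unfolding h_def by (rule divide_left_mono) (use assms(1) in auto)
  then have "h < pi" using pi_gt_zero by linarith
  moreover have "0 < h" using assms(1) by (simp add: h_def)
  ultimately have s: "sin h > 0" by (intro sin_gt_zero)
  have "2 * sin h * cos (\<theta> j) = sin (\<theta> (Suc j) - h) - sin (\<theta> j - h)" for j
  proof -
    have "\<theta> (Suc j) = \<theta> j + 2 * h"
      by (simp add: \<theta>_def h_def distrib_left add_divide_distrib)
    then have shift: "\<theta> (Suc j) - h = \<theta> j + h" by simp
    show ?thesis unfolding shift sin_add sin_diff by simp
  qed
  then have "2 * sin h * (\<Sum>j<m. cos (\<theta> j)) = (\<Sum>j<m. sin (\<theta> (Suc j) - h) - sin (\<theta> j - h))"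
    unfolding sum_distrib_left by (intro sum.cong refl)
  also have "\<dots> = sin (\<theta> m - h) - sin (\<theta> 0 - h)" by (rule sum_lessThan_telescope)
  also have "\<theta> 0 = \<alpha>" by (simp add: \<theta>_def)
  also have "\<theta> m - h = (\<alpha> - h) + pi" using assms(1) by (simp add: \<theta>_def)
  also have "sin (\<alpha> - h + pi) - sin (\<alpha> - h) = - (2 * sin (\<alpha> - h))"
    unfolding sin_periodic_pi by simp
  finally have prod: "2 * sin h * (\<Sum>j<m. cos (\<theta> j)) = - (2 * sin (\<alpha> - h))" .
  have "2 * (\<Sum>j<m. cos (\<theta> j)) = - (2 * sin (\<alpha> - h)) / sin h"
    unfolding prod[symmetric] using s by simp
  then show ?thesis unfolding sum h_def .
qed

text \<open>Each root counts once; for positive \<open>k\<close> and nonzero \<open>s\<close> this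
  agrees with the energy of \<open>x^k - s\<close>, whose roots are then simple.\<close>

definition cycle_energy :: "nat \<Rightarrow> int \<Rightarrow> real" where
  "cycle_energy k s = (\<Sum>z | z ^ k = (of_int s :: complex). \<bar>Re z\<bar>)"

section \<open>Closed forms for the energy of an even cycle\<close>

lemma cis_half_pi_power: "cis (- (pi / 2)) ^ (2 * m) = (-1) ^ m"
  by (simp add: power_mult)

text \<open>For this sign the roots lie symmetrically about the real axis and avoid the imaginary
  axis, so the enumeration starts half a step after -i. The exponent \<open>Suc m\<close> encodes
  the length modulo 4.\<close>

lemma cycle_energy_csc:
  assumes "m > 0"
  shows "cycle_energy (2 * m) ((-1) ^ Suc m) = 2 / sin (pi / (2 * m))"
proof -
  let ?\<alpha> = "- (pi / 2) + pi / (2 * m)"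
  have "cis ?\<alpha> ^ (2 * m) = cis (- (pi / 2)) ^ (2 * m) * cis (pi / (2 * m)) ^ (2 * m)"
    by (simp only: cis_mult power_mult_distrib[symmetric])
  also have "\<dots> = (-1) ^ m * cis pi"
    unfolding cis_half_pi_power using assms by (simp add: DeMoivre)
  finally have "cis ?\<alpha> ^ (2 * m) = of_int ((-1) ^ Suc m)" by simp
  then have "cycle_energy (2 * m) ((-1) ^ Suc m) = - (2 * sin (?\<alpha> - pi / (2 * m))) / sin (pi / (2 * m))"
    unfolding cycle_energy_def
  proof (rule sum_abs_Re_nth_roots[OF assms])
    have "pi * (real m - 1) / m = pi - pi / m" using assms by (simp add: field_simps)
    moreover have "pi / real (2 * m) = pi / m / 2" by simp
    moreover have "0 \<le> pi / m" by simp
    ultimately show "?\<alpha> + pi * (real m - 1) / m \<le> pi / 2" by linarith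
  qed simp
  then show ?thesis by simp
qed

text \<open>For this sign -i is itself a root and serves as the starting point. The pair i, -i
  contributes nothing, and for \<open>m = 1\<close> there are no other roots.\<close>

lemma cycle_energy_cot:
  assumes "m > 0"
  shows "cycle_energy (2 * m) ((-1) ^ m) = 2 * cos (pi / (2 * m)) / sin (pi / (2 * m))"
proof -
  have "cycle_energy (2 * m) ((-1) ^ m) = - (2 * sin (- (pi / 2) - pi / (2 * m))) / sin (pi / (2 * m))"
    unfolding cycle_energy_def
  proof (rule sum_abs_Re_nth_roots[OF assms])
    have "pi * (real m - 1) / m = pi - pi / m" using assms by (simp add: field_simps)
    moreover have "0 \<le> pi / m" by simp
    ultimately show "- (pi / 2) + pi * (real m - 1) / m \<le> pi / 2" by linarith
  qed (simp_all add: cis_half_pi_power del: cis_minus_pi_half)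
  also have "sin (- (pi / 2) - pi / (2 * m)) = - cos (pi / (2 * m))"
    by (simp add: sin_diff)
  finally show ?thesis by simp
qed

lemma cycle_energy_le_csc:
  assumes "even k" "k > 0" "s \<in> {-1, 1}"
  shows "cycle_energy k s \<le> 2 / sin (pi / k)"
proof -
  obtain m where k: "k = 2 * m" using assms(1) by (elim evenE)
  then have m: "m > 0" using assms(2) by simp
  have "sin (pi / k) > 0" using m by (intro sin_gt_zero) (auto simp: k field_simps)
  have "s = (-1) ^ Suc m \<or> s = (-1) ^ m" using assms(3) by (cases "even m") auto
  then show ?thesis
  proof
    assume "s = (-1) ^ m"
    then have "cycle_energy k s = 2 * cos (pi / k) / sin (pi / k)"
      using cycle_energy_cot[OF m] by (simp add: k)
    also have "\<dots> \<le> 2 / sin (pi / k)"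
      using \<open>sin (pi / k) > 0\<close> by (simp add: divide_right_mono)
    finally show ?thesis .
  qed (use cycle_energy_csc[OF m] k in simp)
qed

subsection \<open>A cosecant inequality\<close>

text \<open>The quadratic coefficient of sine is zero, so the three-term Maclaurin sum is just x and
  its remainder is already cubic.\<close>

lemma sin_ge_cubic:
  fixes x :: real
  assumes "x \<ge> 0"
  shows "x - x ^ 3 / 6 \<le> sin x"
proof -
  have "\<bar>sin x - (\<Sum>m<3. sin_coeff m * x ^ m)\<bar> \<le> inverse (fact 3) * \<bar>x\<bar> ^ 3"
    by (rule Maclaurin_sin_bound)
  moreover have "(\<Sum>m<3. sin_coeff m * x ^ m) = x"
    by (simp add: numeral_3_eq_3 sin_coeff_def)
  moreover have "inverse (fact 3) * \<bar>x\<bar> ^ 3 = x ^ 3 / 6"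
    using assms by (simp add: fact_numeral)
  ultimately show ?thesis by linarith
qed

lemma pi_ge_3: "pi \<ge> 3"
  using sin_x_le_x[of "pi / 6"] by (simp add: sin_30)

text \<open>If pi were larger, pi/6 would exceed 0.55, where the cubic bound already gives sine
  about 0.522, contradicting \<open>sin (pi / 6) = 1 / 2\<close>.\<close>

lemma pi_le_33_10: "pi \<le> 33 / 10"
proof (rule ccontr)
  assume "\<not> pi \<le> 33 / 10"
  then have lo: "33 / 60 < pi / 6" by simp
  have "sin (33 / 60) < sin (pi / 6)"
    by (rule sin_monotone_2pi[OF _ lo]) (use pi_ge_3 in auto)
  moreover have "33 / 60 - (33 / 60) ^ 3 / 6 \<le> sin (33 / 60 :: real)" by (rule sin_ge_cubic) simp
  moreover have "33 / 60 - (33 / 60) ^ 3 / 6 > (1 / 2 :: real)" by (simp add: field_simps)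
  ultimately show False by (simp add: sin_30)
qed

lemma csc_mono:
  fixes x y :: real
  assumes "2 \<le> x" "x \<le> y"
  shows "1 / sin (pi / x) \<le> 1 / sin (pi / y)"
proof -
  have yx: "pi / y \<le> pi / x" by (rule divide_left_mono) (use assms in auto)
  have x2: "pi / x \<le> pi / 2" by (rule divide_left_mono) (use assms in auto)
  have y0: "0 < pi / y" using assms by simp
  have "sin (pi / y) \<le> sin (pi / x)"
    by (rule sin_monotone_2pi_le[OF _ yx x2]) (use y0 pi_gt_zero in linarith)
  moreover have "0 < sin (pi / y)"
    by (rule sin_gt_zero[OF y0]) (use yx x2 pi_gt_zero in linarith)
  ultimately show ?thesis by (simp add: frac_le)
qed

lemma csc_ge: "1 / sin (pi / x) \<ge> x / pi" if "x \<ge> 2"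
proof -
  have "sin (pi / x) > 0" using that by (intro sin_gt_zero) (auto simp: field_simps)
  moreover have "sin (pi / x) \<le> pi / x" using that by (intro sin_x_le_x) auto
  ultimately have "1 / (pi / x) \<le> 1 / sin (pi / x)" by (intro frac_le) auto
  then show ?thesis by simp
qed

text \<open>With t = pi/x, the cubic lower bound for sine reduces the claim to t \<le> 1 - t^2/6.
  That inequality holds up to t of about 0.87, hence at pi/4 but not at pi/2, which is why x starts
  at 4.\<close>

lemma csc_le: "1 / sin (pi / x) \<le> x / pi + 1 / 6" if "x \<ge> 4"
proof -
  define t where "t = pi / x"
  have t0: "t > 0" using that by (simp add: t_def)
  have "t \<le> pi / 4" unfolding t_def using that by (intro divide_left_mono) auto
  then have t1: "t \<le> 33 / 40" using pi_le_33_10 by simp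
  have "t\<^sup>2 \<le> (33 / 40)\<^sup>2" using t0 t1 by (intro power_mono) auto
  then have t2: "t \<le> 1 - t\<^sup>2 / 6" using t1 by (simp add: power2_eq_square)
  have c: "sin t \<ge> t - t ^ 3 / 6" using t0 by (intro sin_ge_cubic) simp
  have e: "t - t ^ 3 / 6 = t * (1 - t\<^sup>2 / 6)" by (simp add: algebra_simps power2_eq_square power3_eq_cube)
  have "t - t ^ 3 / 6 > 0" unfolding e using t0 t2 by simp
  then have "0 < sin t" using c by simp
  have "1 \<le> (1 / t + 1 / 6) * (t - t ^ 3 / 6)"
  proof -
    have "(1 / t + 1 / 6) * (t - t ^ 3 / 6) = 1 + t / 6 * (1 - t\<^sup>2 / 6 - t)"
      using t0 by (simp add: field_simps power2_eq_square power3_eq_cube)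
    moreover have "0 \<le> t / 6 * (1 - t\<^sup>2 / 6 - t)" using t0 t2 by simp
    ultimately show ?thesis by simp
  qed
  also have "\<dots> \<le> (1 / t + 1 / 6) * sin t" using t0 c by (intro mult_left_mono) auto
  finally have "1 / sin t \<le> 1 / t + 1 / 6" using \<open>0 < sin t\<close> by (simp add: pos_divide_le_eq)
  then show ?thesis by (simp add: t_def)
qed

text \<open>Since \<open>csc (\<pi>/x) - x/\<pi>\<close> is at most 1/6 from 4 on but equals \<open>1 - 2/\<pi> \<ge> 1/3\<close>
  at 2, replacing the pair \<open>(p, q)\<close> by \<open>(2, p + q - 2)\<close> does not decrease the sum.\<close>
lemma csc_add_le:
  fixes p q :: nat
  assumes "even p" "even q" "p \<ge> 2" "q \<ge> 2" "p + q \<le> N"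
  shows "1 / sin (pi / p) + 1 / sin (pi / q) \<le> 1 + 1 / sin (pi / real (N - 2))"
proof -
  consider "p = 2" | "q = 2" | "p \<ge> 4" "q \<ge> 4"
  proof -
    have "p \<noteq> 3" "q \<noteq> 3" using assms(1,2) by auto
    then have "p = 2 \<or> p \<ge> 4" "q = 2 \<or> q \<ge> 4" using assms(3,4) by linarith+
    then show thesis using that by blast
  qed
  then show ?thesis
  proof cases
    case 1
    then show ?thesis using csc_mono[of q "real (N - 2)"] assms by simp
  next
    case 2
    then show ?thesis using csc_mono[of p "real (N - 2)"] assms by simp
  next
    case 3
    have "1 / sin (pi / p) + 1 / sin (pi / q) \<le> p / pi + q / pi + 1 / 3"
      using csc_le[of p] csc_le[of q] 3 by simp
    also have "\<dots> \<le> 1 + (p + q - 2) / pi"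
    proof -
      have "real (p + q - 2) / pi = p / pi + q / pi - 2 / pi"
        using 3 by (simp add: of_nat_diff add_divide_distrib diff_divide_distrib)
      moreover have "2 / pi \<le> 2 / 3" using pi_ge_3 by (intro divide_left_mono) auto
      ultimately show ?thesis by linarith
    qed
    also have "(p + q - 2) / pi \<le> real (N - 2) / pi"
      using assms(5) 3 by (intro divide_right_mono) auto
    also have "real (N - 2) / pi \<le> 1 / sin (pi / real (N - 2))"
      using assms(3-5) by (intro csc_ge) auto
    finally show ?thesis by simp
  qed
qed

subsection \<open>Sidigraphs with prescribed cycles\<close>

lemma cycle_of_list_in_set_iff: "cycle_of_list vs v \<in> set vs \<longleftrightarrow> v \<in> set vs"
  by (rule permutes_in_image[OF cycle_permutes])

text \<open>A cycle is a single orbit, so iterating from one member reaches all of them without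
  leaving a set that is closed under the step.\<close>

lemma cycle_subset_of_closed:
  assumes "distinct us" "u \<in> set us" "u \<in> S"
    and closed: "\<And>v. v \<in> set us \<Longrightarrow> v \<in> S \<Longrightarrow> cycle_of_list us v \<in> S"
  shows "set us \<subseteq> S"
proof -
  from assms(2) obtain i where i: "i < length us" "u = us ! i" by (auto simp: set_conv_nth)
  have *: "us ! ((i + k) mod length us) \<in> S" for k
  proof (induction k)
    case 0
    then show ?case using i assms(3) by simp
  next
    case (Suc k)
    have "(i + k) mod length us < length us" using i by (intro mod_less_divisor) auto
    with closed[OF nth_mem Suc] cycle_of_list_nth[OF assms(1)] show ?case
      by (simp add: mod_Suc_eq)
  qed
  show ?thesis
  proof
    fix v assume "v \<in> set us"
    then obtain j where j: "j < length us" "v = us ! j" by (auto simp: set_conv_nth)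
    \<comment> \<open>Going round by \<open>j + (length us - i)\<close> steps avoids the truncated
      difference \<open>j - i\<close>, which would be wrong for \<open>j < i\<close>.\<close>
    have "(i + (j + (length us - i))) mod length us = j" using i j by simp
    then show "v \<in> S" using *[of "j + (length us - i)"] j by simp
  qed
qed

definition interval_cycle :: "nat \<Rightarrow> nat \<Rightarrow> (nat \<times> nat) set" where
  "interval_cycle l r = (\<lambda>v. (v, if Suc v = r then l else Suc v)) ` {l..<r}"

lemma cycle_arcs_upt: "cycle_arcs [l..<r] = interval_cycle l r"
proof -
  have "cycle_arcs [l..<r] = (\<lambda>v. (v, if Suc v = r then l else Suc v)) ` set [l..<r]"
  proof (rule cycle_arcs_eq_imageI)
    fix i assume "i < length [l..<r]"
    then show "[l..<r] ! ((i + 1) mod length [l..<r]) =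
        (if Suc ([l..<r] ! i) = r then l else Suc ([l..<r] ! i))"
      by (cases "Suc i = r - l") auto
  qed
  then show ?thesis by (simp add: interval_cycle_def)
qed

text \<open>The closing arc puts \<open>l\<close> on the cycle and the successor steps climb from
  there through the whole interval; conversely the interval is closed under these steps, so the
  cycle cannot leave it.\<close>

lemma cycle_arcs_eq_interval_cycle:
  assumes us: "distinct us" and "l < r" "r - 1 \<in> set us" "cycle_of_list us (r - 1) = l"
    and step: "\<And>v. v \<in> set us \<Longrightarrow> l \<le> v \<Longrightarrow> Suc v < r \<Longrightarrow> cycle_of_list us v = Suc v"
  shows "cycle_arcs us = interval_cycle l r"
proof -
  have mem: "cycle_of_list us v \<in> set us" if "v \<in> set us" for v
    using that by (simp add: cycle_of_list_in_set_iff)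
  have f: "cycle_of_list us v = (if Suc v = r then l else Suc v)" if "v \<in> set us" "v \<in> {l..<r}" for v
    using that step[of v] assms(4) by auto
  have "set us \<subseteq> {l..<r}"
    by (rule cycle_subset_of_closed[OF us assms(3)]) (use f assms(2) in auto)
  moreover have "l + k < r \<Longrightarrow> l + k \<in> set us" for k
  proof (induction k)
    case 0
    then show ?case using mem[OF assms(3)] assms(4) by simp
  next
    case (Suc k)
    then show ?case using mem[of "l + k"] step[of "l + k"] by simp
  qed
  then have "{l..<r} \<subseteq> set us"
    by (metis atLeastLessThan_iff le_iff_add subsetI)
  ultimately have "set us = {l..<r}" by blast
  then show ?thesis
    using f by (auto simp: cycle_arcs_eq_image[OF us] interval_cycle_def)
qed

text \<open>A positive directed path through all vertices gives connectedness but no cycle; each of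
  the two back arcs closes one block of the path and alone determines the sign of that cycle.
  Vertices from \<open>p + q\<close> on form a tail.\<close>

definition two_back_arcs :: "nat \<Rightarrow> nat \<Rightarrow> nat \<Rightarrow> int \<Rightarrow> int \<Rightarrow> nat \<Rightarrow> nat \<Rightarrow> int" where
  "two_back_arcs n p q s t i j =
    (if i < n \<and> j < n then
       if j = Suc i then 1
       else if Suc i = p \<and> j = 0 then s
       else if Suc i = p + q \<and> j = p then t
       else 0
     else 0)"

lemma cycle_sign_interval_cycle:
  assumes "l < r" "\<And>v. l \<le> v \<Longrightarrow> Suc v < r \<Longrightarrow> a v (Suc v) = 1"
  shows "cycle_sign a (interval_cycle l r) = a (r - 1) l"
proof -
  have "cycle_sign a (interval_cycle l r) = (\<Prod>v\<in>{l..<r}. a v (if Suc v = r then l else Suc v))"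
    by (simp add: cycle_sign_def interval_cycle_def prod.reindex inj_on_def)
  also have "{l..<r} = insert (r - 1) {l..<r - 1}" using assms(1) by auto
  also have "(\<Prod>v\<in>\<dots>. a v (if Suc v = r then l else Suc v)) = a (r - 1) l"
  proof -
    have "(\<Prod>v\<in>{l..<r - 1}. a v (if Suc v = r then l else Suc v)) = 1"
      by (rule prod.neutral) (use assms(2) in auto)
    then show ?thesis using assms(1) by simp
  qed
  finally show ?thesis .
qed

text \<open>This supplies the existence half of each claim: every admissible choice of lengths and
  signs is realised, so the extremal types are not vacuous.\<close>

lemma has_cycle_type_two_back_arcs:
  assumes "p \<ge> 2" "q \<ge> 2" "p + q \<le> n" "s \<in> {-1, 1}" "t \<in> {-1, 1}"
  shows "has_cycle_type n (two_back_arcs n p q s t) p s q t"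
proof -
  let ?a = "two_back_arcs n p q s t"
  let ?C = "interval_cycle 0 p" and ?D = "interval_cycle p (p + q)"
  have nz: "s \<noteq> 0" "t \<noteq> 0" using assms by auto
  have mem: "interval_cycle l r \<in> dcycles n ?a"
    if lr: "(l, r) = (0, p) \<or> (l, r) = (p, p + q)" for l r
  proof -
    have r: "r \<le> n" "l + 2 \<le> r" using lr assms(1-3) by auto
    have "?a (r - 1) l \<noteq> 0"
      using lr
    proof
      assume "(l, r) = (0, p)"
      then show ?thesis using assms(1-3) nz by (simp add: two_back_arcs_def)
    next
      assume "(l, r) = (p, p + q)"
      then show ?thesis using assms(1-3) nz by (simp add: two_back_arcs_def)
    qed
    then have "(v, if Suc v = r then l else Suc v) \<in> arcs n ?a" if "v \<in> {l..<r}" for v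
      using that r by (auto simp: arcs_def) (simp add: two_back_arcs_def)
    then have "cycle_arcs [l..<r] \<subseteq> arcs n ?a"
      unfolding cycle_arcs_upt interval_cycle_def by blast
    moreover have "distinct [l..<r]" "length [l..<r] \<ge> 2" using r by auto
    ultimately show ?thesis unfolding dcycles_def cycle_arcs_upt[symmetric] by blast
  qed
  have only: "C = ?C \<or> C = ?D" if "C \<in> dcycles n ?a" for C
    using that
  proof (rule dcyclesE)
    fix us assume us: "distinct us" "length us \<ge> 2" "C = cycle_arcs us"
      and arc: "\<And>v. v \<in> set us \<Longrightarrow> cycle_of_list us v < n \<and> ?a v (cycle_of_list us v) \<noteq> 0"
    \<comment> \<open>The largest vertex of a cycle can only be left along one of the two back arcs.\<close>
    define m where "m = Max (set us)"
    have m: "m \<in> set us" unfolding m_def using us(2) by (intro Max_in) auto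
    have "cycle_of_list us m \<in> set us"
      using m by (simp add: cycle_of_list_in_set_iff)
    then have "cycle_of_list us m \<le> m" unfolding m_def by (intro Max_ge) auto
    then have closing: "Suc m = p \<and> cycle_of_list us m = 0 \<or> Suc m = p + q \<and> cycle_of_list us m = p"
      using arc[OF m] by (auto simp: two_back_arcs_def split: if_splits)
    have step: "cycle_of_list us v = Suc v" if "v \<in> set us" "Suc v \<noteq> p" "Suc v \<noteq> p + q" for v
      using arc[OF that(1)] that by (auto simp: two_back_arcs_def split: if_splits)
    from closing show ?thesis
    proof
      assume *: "Suc m = p \<and> cycle_of_list us m = 0"
      have "cycle_arcs us = ?C"
        by (rule cycle_arcs_eq_interval_cycle) (use us * m step in auto)
      then show ?thesis using us by simp
    next
      assume *: "Suc m = p + q \<and> cycle_of_list us m = p"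
      then have m_eq: "m = p + q - 1" by (metis diff_Suc_1)
      have "cycle_arcs us = ?D"
        by (rule cycle_arcs_eq_interval_cycle) (use us * m step assms(2) m_eq in auto)
      then show ?thesis using us by simp
    qed
  qed
  have dc: "dcycles n ?a = {?C, ?D}" using only mem by blast
  have verts: "cycle_vertices (interval_cycle l r) = {l..<r}" for l r
    by (auto simp: cycle_vertices_def interval_cycle_def image_image)
  have len: "cycle_length (interval_cycle l r) = r - l" for l r
    by (simp add: cycle_length_def interval_cycle_def card_image inj_on_def)
  have "?C \<noteq> ?D" using verts[of 0 p] verts[of p "p + q"] assms by auto
  have sC: "cycle_sign ?a ?C = s" and sD: "cycle_sign ?a ?D = t"
    using assms by (subst cycle_sign_interval_cycle; auto simp: two_back_arcs_def)+
  have "(0, i) \<in> (arcs n ?a \<union> (arcs n ?a)\<inverse>)\<^sup>*" if "i < n" for i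
    using that
  proof (induction i)
    case (Suc i)
    then have "(i, Suc i) \<in> arcs n ?a" by (simp add: arcs_def two_back_arcs_def)
    with Suc show ?case by (meson Suc_lessD UnI1 rtrancl.rtrancl_into_rtrancl)
  qed simp
  then have "underlying_connected n ?a"
    unfolding underlying_connected_def
    by (meson rtrancl_trans sym_Un_converse sym_rtrancl symD)
  moreover have "sidigraph n ?a"
    using assms by (auto simp: sidigraph_def two_back_arcs_def)
  ultimately have "bicyclic_vd n ?a"
    using \<open>?C \<noteq> ?D\<close> verts unfolding bicyclic_vd_def dc by auto
  then show ?thesis
    unfolding has_cycle_type_def dc using \<open>?C \<noteq> ?D\<close> len[of 0 p] len[of p "p + q"] sC sD by auto
qed

subsection \<open>Energies of bicyclic vertex-disjoint sidigraphs\<close>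

text \<open>Everything used later about an arbitrary member of the class is gathered here. Energy is
  additive because the characteristic polynomial is a product with one factor per cycle, and the
  remaining power of x has only the root 0.\<close>

lemma bicyclic_vd_energy:
  assumes "bicyclic_vd n a" and C: "C \<in> dcycles n a" and D: "D \<in> dcycles n a" and "C \<noteq> D"
  shows "dcycles n a = {C, D}"
    and "2 \<le> cycle_length C" "2 \<le> cycle_length D" "cycle_length C + cycle_length D \<le> n"
    and "cycle_sign a C \<in> {-1, 1}" "cycle_sign a D \<in> {-1, 1}"
    and "energy n a = cycle_energy (cycle_length C) (cycle_sign a C) +
      cycle_energy (cycle_length D) (cycle_sign a D)"
proof -
  have sd: "sidigraph n a" and card: "card (dcycles n a) = 2"
    and vd: "cycle_vertices C \<inter> cycle_vertices D = {}"
    using assms unfolding bicyclic_vd_def by blast+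
  have "finite (dcycles n a)" using card by (metis card.infinite zero_neq_numeral)
  then show dc: "dcycles n a = {C, D}"
    using card C D \<open>C \<noteq> D\<close> by (intro card_subset_eq[symmetric]) auto
  obtain vs where vs: "distinct vs" "length vs \<ge> 2" "C = cycle_arcs vs" "set vs \<subseteq> {0..<n}"
    "\<And>v. v \<in> set vs \<Longrightarrow> cycle_of_list vs v < n \<and> a v (cycle_of_list vs v) \<noteq> 0"
    using dcyclesE[OF C] by metis
  obtain ws where ws: "distinct ws" "length ws \<ge> 2" "D = cycle_arcs ws" "set ws \<subseteq> {0..<n}"
    "\<And>v. v \<in> set ws \<Longrightarrow> cycle_of_list ws v < n \<and> a v (cycle_of_list ws v) \<noteq> 0"
    using dcyclesE[OF D] by metis
  have disj: "set vs \<inter> set ws = {}"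
    using vd vs ws by (simp add: cycle_vertices_cycle_arcs)
  have len: "cycle_length C = length vs" "cycle_length D = length ws"
    using vs ws by (simp_all add: cycle_length_cycle_arcs)
  show "2 \<le> cycle_length C" "2 \<le> cycle_length D" using len vs ws by simp_all
  have "card (set vs \<union> set ws) \<le> card {0..<n}" by (intro card_mono) (use vs ws in auto)
  then show "cycle_length C + cycle_length D \<le> n"
    using disj vs ws len by (simp add: card_Un_disjoint distinct_card)
  have unit: "(\<Prod>v\<in>A. a v (f v)) \<in> {-1, 1}" if "\<And>v. v \<in> A \<Longrightarrow> a v (f v) \<noteq> 0" for A f
    using that
  proof (induction A rule: infinite_finite_induct)
    case (insert x A)
    have "a x (f x) \<in> {-1, 0, 1}" using sd unfolding sidigraph_def by blast
    with insert show ?case by auto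
  qed auto
  show sC: "cycle_sign a C \<in> {-1, 1}"
    unfolding vs(3) cycle_sign_cycle_arcs[OF vs(1)] by (rule unit) (use vs in auto)
  show sD: "cycle_sign a D \<in> {-1, 1}"
    unfolding ws(3) cycle_sign_cycle_arcs[OF ws(1)] by (rule unit) (use ws in auto)
  have diag: "a i i = 0" for i using sd unfolding sidigraph_def by blast
  note char_poly_two_disjoint_cycles[OF diag dc[unfolded vs(3) ws(3)] vs(1,2) ws(1,2) disj,
      folded vs(3) ws(3), folded len]
  moreover have "of_int (cycle_sign a C) \<noteq> (0 :: complex)" "of_int (cycle_sign a D) \<noteq> (0 :: complex)"
    using sC sD by auto
  moreover have "cycle_length C > 0" "cycle_length D > 0" using len vs ws by auto
  ultimately show "energy n a = cycle_energy (cycle_length C) (cycle_sign a C) +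
      cycle_energy (cycle_length D) (cycle_sign a D)"
    using poly_energy_nth_roots
    by (simp add: energy_eq_poly_energy poly_energy_mult poly_energy_monom cycle_energy_def)
qed

text \<open>Stating the bound with an even \<open>N\<close> and \<open>n \<le> Suc N\<close> treats
  both parities of n together: the total cycle length is even, so it cannot equal
  \<open>Suc N\<close> and is at most \<open>N\<close>.\<close>

lemma even_cycles_energy_le:
  assumes "bicyclic_vd n a" "even_cycles n a" "even N" "n \<le> Suc N"
  shows "energy n a \<le> 2 + 2 / sin (pi / real (N - 2))"
proof -
  obtain C D where CD: "C \<in> dcycles n a" "D \<in> dcycles n a" "C \<noteq> D"
    using assms(1) unfolding bicyclic_vd_def by (metis card_2_iff insertCI)
  note E = bicyclic_vd_energy[OF assms(1) CD]
  let ?p = "cycle_length C" and ?q = "cycle_length D"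
  have ev: "even ?p" "even ?q" using assms(2) CD unfolding even_cycles_def by auto
  have "?p + ?q \<noteq> Suc N" using ev assms(3) by (metis even_Suc even_add)
  then have le: "?p + ?q \<le> N" using E(4) assms(4) by simp
  have "energy n a \<le> 2 / sin (pi / ?p) + 2 / sin (pi / ?q)"
    unfolding E(7) using E(2,3,5,6) ev by (intro add_mono cycle_energy_le_csc) auto
  also have "\<dots> \<le> 2 + 2 / sin (pi / real (N - 2))"
    using csc_add_le[OF ev E(2,3) le] by simp
  finally show ?thesis .
qed

lemma has_cycle_type_energy:
  assumes "has_cycle_type n t p s q s'"
  shows "energy n t = cycle_energy p s + cycle_energy q s'"
  using assms bicyclic_vd_energy(7) unfolding has_cycle_type_def by blast

lemma has_cycle_type_even_cycles:
  assumes "has_cycle_type n t p s q s'" "even p" "even q"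
  shows "bicyclic_vd n t" "even_cycles n t"
  using assms bicyclic_vd_energy(1) unfolding has_cycle_type_def even_cycles_def by blast+

text \<open>Both cycles carry the sign that reaches the cosecant, so the upper bound for
  \<open>N = 2 * m + 2\<close> is met with equality.\<close>

lemma has_cycle_type_max_even:
  assumes t: "has_cycle_type n t 2 1 (2 * m) ((-1) ^ Suc m)" and "m > 0" "n \<le> 2 * m + 3"
  shows "max_even n t"
proof -
  have "energy n t = 2 + 2 / sin (pi / real (2 * m))"
    using has_cycle_type_energy[OF t] cycle_energy_csc[of 1] cycle_energy_csc[OF assms(2)] by simp
  moreover have "energy n s \<le> 2 + 2 / sin (pi / real (2 * m))"
    if "bicyclic_vd n s" "even_cycles n s" for s
    using even_cycles_energy_le[OF that, of "2 * m + 2"] assms(3) by simp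
  ultimately show ?thesis
    using has_cycle_type_even_cycles[OF t] by (simp add: max_even_def)
qed

theorem theorem3p12:
  fixes n :: nat
  assumes "n > 5"
  shows "(n mod 4 = 0 \<longrightarrow>
            (\<exists>t. has_cycle_type n t 2 1 (n - 2) 1) \<and>
            (\<forall>t. has_cycle_type n t 2 1 (n - 2) 1 \<longrightarrow> max_even n t))
       \<and> (n mod 4 = 2 \<longrightarrow>
            (\<exists>t. has_cycle_type n t 2 1 (n - 2) (-1)) \<and>
            (\<forall>t. has_cycle_type n t 2 1 (n - 2) (-1) \<longrightarrow> max_even n t))
       \<and> (n mod 4 = 1 \<longrightarrow>
            (\<exists>t. has_cycle_type n t 2 1 (n - 3) 1) \<and>
            (\<forall>t. has_cycle_type n t 2 1 (n - 3) 1 \<longrightarrow> max_even n t))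
       \<and> (n mod 4 = 3 \<longrightarrow>
            (\<exists>t. has_cycle_type n t 2 1 (n - 3) (-1)) \<and>
            (\<forall>t. has_cycle_type n t 2 1 (n - 3) (-1) \<longrightarrow> max_even n t))
       \<and> (\<exists>t. has_cycle_type n t 2 (-1) 2 (-1)) \<and>
         (\<forall>t. has_cycle_type n t 2 (-1) 2 (-1) \<longrightarrow> min_even n t \<and> energy n t = 0)"
proof -
  \<comment> \<open>All four residues are instances: \<open>k\<close> is n - 2 or n - 3 according to
    parity, and \<open>m\<close> is odd, giving sign 1, for residues 0 and 1, and even, giving sign
    -1, for residues 2 and 3.\<close>
  have max: "(\<exists>t. has_cycle_type n t 2 1 k s) \<and> (\<forall>t. has_cycle_type n t 2 1 k s \<longrightarrow> max_even n t)"
    if "k = 2 * m" "s = (-1) ^ Suc m" "m > 0" "k + 2 \<le> n" "n \<le> k + 3" for k m s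
  proof -
    have "s \<in> {-1, 1}" using that(2) by (cases "even m") auto
    then show ?thesis
      using has_cycle_type_two_back_arcs[of 2 k n 1 s] has_cycle_type_max_even[of n _ m] that by auto
  qed
  obtain j where "n = 4 * j + n mod 4" by (metis mult_div_mod_eq)
  then have j: "n mod 4 = r \<Longrightarrow> n = 4 * j + r" for r by simp
  have "min_even n t \<and> energy n t = 0" if t: "has_cycle_type n t 2 (-1) 2 (-1)" for t
  proof -
    \<comment> \<open>The cotangent form at \<open>m = 1\<close> contains the factor
      \<open>cos (pi / 2) = 0\<close>.\<close>
    have "energy n t = 0" using has_cycle_type_energy[OF t] cycle_energy_cot[of 1] by simp
    moreover have "0 \<le> energy n s" for s by (simp add: energy_def Let_def sum_nonneg)
    ultimately show ?thesis using has_cycle_type_even_cycles[OF t] by (simp add: min_even_def)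
  qed
  moreover have "\<exists>t. has_cycle_type n t 2 (-1) 2 (-1)"
    using has_cycle_type_two_back_arcs[of 2 2 n "-1" "-1"] assms by auto
  moreover have "(\<exists>t. has_cycle_type n t 2 1 (n - 2) 1) \<and>
      (\<forall>t. has_cycle_type n t 2 1 (n - 2) 1 \<longrightarrow> max_even n t)" if "n mod 4 = 0"
    by (rule max[of _ "2 * j - 1"]) (use j[OF that] assms in auto)
  moreover have "(\<exists>t. has_cycle_type n t 2 1 (n - 2) (-1)) \<and>
      (\<forall>t. has_cycle_type n t 2 1 (n - 2) (-1) \<longrightarrow> max_even n t)" if "n mod 4 = 2"
    by (rule max[of _ "2 * j"]) (use j[OF that] assms in auto)
  moreover have "(\<exists>t. has_cycle_type n t 2 1 (n - 3) 1) \<and>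
      (\<forall>t. has_cycle_type n t 2 1 (n - 3) 1 \<longrightarrow> max_even n t)" if "n mod 4 = 1"
    by (rule max[of _ "2 * j - 1"]) (use j[OF that] assms in auto)
  moreover have "(\<exists>t. has_cycle_type n t 2 1 (n - 3) (-1)) \<and>
      (\<forall>t. has_cycle_type n t 2 1 (n - 3) (-1) \<longrightarrow> max_even n t)" if "n mod 4 = 3"
    by (rule max[of _ "2 * j"]) (use j[OF that] assms in auto)
  ultimately show ?thesis by blast
qed

end
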